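(* Let $G$ be a finite weighted graph with vertex set $V$ and graph Laplacian $\mathcal{L}$. If $U\subset V$ is a subset of vertices for which $S=V\setminus U$ is a $\Lambda$-set, then there exist weights $\sigma_u=\sigma_u(U)\in\mathbb{R}$, $u\in U$, such that for every function $f\in\mathbf{E}_\omega(\mathcal{L})$, where $$0<\omega<\frac1\Lambda,$$ the following exact formula holds: $$\sum_{v\in V}f(v)=\sum_{u\in U}f(u)\sigma_u .$$
   Context: $G$ is an undirected weighted graph with finite vertex set $V=V(G)$ and symmetric weight function $w:V\times V\to[0,\infty)$, $w(u,v)=w(v,u)$, $w(u,u)=0$; pairs with $w(u,v)\neq0$ are edges. $L_2(G)$ is the space of real-valued functions on $V$ with inner product $\langle f,g\rangle=\sum_{v\in V}f(v)g(v)$ and norm $\|f\|=\left(\sum_{v\in V}|f(v)|^2\right)^{1/2}$. The Laplacian is $(\mathcal{L}f)(v)=\sum_{u\in V}(f(v)-f(u))w(v,u)$, a positive-semidefinite self-adjoint operator on $L_2(G)$. $\mathbf{E}_\omega(\mathcal{L})$ is the span of the eigenvectors of $\mathcal{L}$ whose eigenvalues are $\le\omega$. For $S\subset V$, $L_2(S)=\{\varphi\in L_2(G):\varphi(v)=0 \text{ for } v\in V\setminus S\}$. The set $S$ is a $\Lambda$-set, where $\Lambda>0$ is a constant, if $\|\varphi\|\le\Lambda\|\mathcal{L}\varphi\|$ for all $\varphi\in L_2(S)$. *)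

theory Defs
  imports "HOL-Analysis.Analysis"
begin

text \<open>
  The vertex set is the universe of a finite type \<open>'v\<close>, and the space of real functions on the
  vertices is \<open>real ^ 'v\<close>, whose library inner product and norm are the unweighted
  \<open>\<ell>\<^sup>2\<close> ones.
\<close>

definition weighted_graph :: "('v::finite \<Rightarrow> 'v \<Rightarrow> real) \<Rightarrow> bool" where
  "weighted_graph w \<longleftrightarrow>
     (\<forall>u v. 0 \<le> w u v) \<and> (\<forall>u v. w u v = w v u) \<and> (\<forall>u. w u u = 0)"

definition laplacian :: "('v::finite \<Rightarrow> 'v \<Rightarrow> real) \<Rightarrow> real ^ 'v \<Rightarrow> real ^ 'v" where
  "laplacian w f = (\<chi> v. \<Sum>u\<in>UNIV. (f $ v - f $ u) * w v u)"

definition is_eigenvector ::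
    "('a::real_vector \<Rightarrow> 'a) \<Rightarrow> real \<Rightarrow> 'a \<Rightarrow> bool" where
  "is_eigenvector T \<mu> f \<longleftrightarrow> f \<noteq> 0 \<and> T f = \<mu> *\<^sub>R f"

definition paley_wiener :: "('a::real_vector \<Rightarrow> 'a) \<Rightarrow> real \<Rightarrow> 'a set" where
  "paley_wiener T \<omega> = span {f. \<exists>\<mu>\<le>\<omega>. is_eigenvector T \<mu> f}"

definition L2_on :: "'v::finite set \<Rightarrow> (real ^ 'v) set" where
  "L2_on S = {\<phi>. \<forall>v. v \<notin> S \<longrightarrow> \<phi> $ v = 0}"

text \<open>Positivity of the constant is not part of this predicate; it has to be assumed separately.\<close>

definition Lambda_set :: "('v::finite \<Rightarrow> 'v \<Rightarrow> real) \<Rightarrow> real \<Rightarrow> 'v set \<Rightarrow> bool" where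
  "Lambda_set w \<Lambda> S \<longleftrightarrow>
     (\<forall>\<phi>\<in>L2_on S. norm \<phi> \<le> \<Lambda> * norm (laplacian w \<phi>))"

end

theory Submission
  imports Defs
begin

text \<open>
  A band-limited function is determined by its values on \<open>U\<close>. Since the Laplacian is self-adjoint
  and positive semidefinite, a function of bandwidth \<open>\<omega>\<close> is an orthogonal sum of eigenvectors with
  eigenvalues in \<open>[0, \<omega>]\<close>, which yields the Bernstein inequality \<open>\<parallel>\<L>f\<parallel> \<le> \<omega>\<parallel>f\<parallel>\<close>
  (\<open>bernstein_inequality\<close>). If such an \<open>f\<close> vanishes on \<open>U\<close>, then it lies in \<open>L2_on (UNIV - U)\<close>, and
  the defining inequality of a \<open>\<Lambda>\<close>-set gives \<open>\<parallel>f\<parallel> \<le> \<Lambda>\<parallel>\<L>f\<parallel> \<le> \<Lambda>\<omega>\<parallel>f\<parallel>\<close>; as \<open>\<Lambda>\<omega> < 1\<close>, this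
  forces \<open>f = 0\<close> (\<open>paley_wiener_uniqueness\<close>).

  The weights must serve all bandwidths \<open>\<omega> < 1/\<Lambda>\<close> simultaneously. The Paley--Wiener spaces are
  nested, so their union is again a subspace, on which restriction to \<open>U\<close> is injective. A linear
  left inverse of the restriction reconstructs \<open>f\<close> linearly from its values on \<open>U\<close>, and composing
  it with any linear functional, such as the sum over all vertices, exhibits that functional as a
  weighted sum over \<open>U\<close> (\<open>linear_functional_from_samples\<close>).
\<close>

lemma linear_laplacian: "linear (laplacian w)"
  by (rule linearI)
    (simp_all add: laplacian_def vec_eq_iff sum.distrib[symmetric] sum_distrib_left algebra_simps)

text \<open>
  Exchanging the two summation indices, with \<open>w\<close> symmetric, replaces the factor \<open>f $ v\<close> by
  \<open>- f $ u\<close>; averaging the two expressions produces the difference \<open>f $ v - f $ u\<close>. The form on the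
  right is symmetric in \<open>f\<close> and \<open>g\<close> and a nonnegative sum for \<open>f = g\<close>, so self-adjointness and
  positivity can be read off from it.
\<close>

lemma laplacian_green:
  assumes "weighted_graph w"
  shows "f \<bullet> laplacian w g =
    (\<Sum>v\<in>UNIV. \<Sum>u\<in>UNIV. (f $ v - f $ u) * (g $ v - g $ u) * w v u) / 2"
proof -
  have sym: "w u v = w v u" for u v
    using assms by (simp add: weighted_graph_def)
  have first: "f \<bullet> laplacian w g = (\<Sum>v\<in>UNIV. \<Sum>u\<in>UNIV. f $ v * (g $ v - g $ u) * w v u)"
    by (simp add: inner_vec_def laplacian_def sum_distrib_left mult.assoc)
  also have "\<dots> = (\<Sum>u\<in>UNIV. \<Sum>v\<in>UNIV. f $ v * (g $ v - g $ u) * w v u)"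
    by (rule sum.swap)
  also have "\<dots> = (\<Sum>v\<in>UNIV. \<Sum>u\<in>UNIV. f $ u * (g $ u - g $ v) * w v u)"
    by (simp add: sym)
  finally have second:
    "f \<bullet> laplacian w g = (\<Sum>v\<in>UNIV. \<Sum>u\<in>UNIV. f $ u * (g $ u - g $ v) * w v u)" .
  have "f \<bullet> laplacian w g + f \<bullet> laplacian w g =
      (\<Sum>v\<in>UNIV. \<Sum>u\<in>UNIV. f $ v * (g $ v - g $ u) * w v u + f $ u * (g $ u - g $ v) * w v u)"
    by (subst first, subst second) (simp add: sum.distrib)
  also have "\<dots> = (\<Sum>v\<in>UNIV. \<Sum>u\<in>UNIV. (f $ v - f $ u) * (g $ v - g $ u) * w v u)"
    by (intro sum.cong refl) (simp add: algebra_simps)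
  finally show ?thesis by simp
qed

lemma laplacian_self_adjoint:
  assumes "weighted_graph w"
  shows "laplacian w f \<bullet> g = f \<bullet> laplacian w g"
  by (subst inner_commute) (simp add: laplacian_green[OF assms] mult.commute)

lemma laplacian_psd:
  assumes "weighted_graph w"
  shows "0 \<le> f \<bullet> laplacian w f"
proof -
  have "0 \<le> w v u" for v u
    using assms by (simp add: weighted_graph_def)
  then show ?thesis
    unfolding laplacian_green[OF assms]
    by (intro divide_nonneg_nonneg sum_nonneg) simp_all
qed

lemma eigenspaces_orthogonal:
  fixes T :: "'a::real_inner \<Rightarrow> 'a"
  assumes "\<And>x y. T x \<bullet> y = x \<bullet> T y"
    and "T x = \<mu> *\<^sub>R x" "T y = \<nu> *\<^sub>R y" "\<mu> \<noteq> \<nu>"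
  shows "x \<bullet> y = 0"
  using assms(1)[of x y] assms(2-4) by simp

text \<open>
  A spanning combination is grouped by eigenvalue, so that distinct summands lie in distinct
  eigenspaces; two eigenvectors in \<open>t\<close> with the same eigenvalue need not be orthogonal.
\<close>

lemma paley_wiener_decomposition:
  assumes lin: "linear T" and f: "f \<in> paley_wiener T \<omega>"
  obtains M g where "finite M" "\<And>\<mu>. T (g \<mu>) = \<mu> *\<^sub>R g \<mu>" "f = (\<Sum>\<mu>\<in>M. g \<mu>)"
    "\<And>\<mu>. \<mu> \<in> M \<Longrightarrow> \<mu> \<le> \<omega> \<and> (\<exists>x. is_eigenvector T \<mu> x)"
proof -
  obtain t r where t: "finite t" "t \<subseteq> {f. \<exists>\<mu>\<le>\<omega>. is_eigenvector T \<mu> f}"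
    and f_eq: "f = (\<Sum>a\<in>t. r a *\<^sub>R a)"
    using f unfolding paley_wiener_def span_explicit by blast
  have "\<forall>a\<in>t. \<exists>\<mu>. \<mu> \<le> \<omega> \<and> is_eigenvector T \<mu> a"
    using t(2) by blast
  then obtain e where e: "\<And>a. a \<in> t \<Longrightarrow> e a \<le> \<omega> \<and> is_eigenvector T (e a) a"
    by metis
  define g where "g \<mu> = (\<Sum>a\<in>{a \<in> t. e a = \<mu>}. r a *\<^sub>R a)" for \<mu>
  show thesis
  proof
    show "finite (e ` t)" using t(1) by simp
    show "T (g \<mu>) = \<mu> *\<^sub>R g \<mu>" for \<mu>
    proof -
      have "T (g \<mu>) = (\<Sum>a\<in>{a \<in> t. e a = \<mu>}. r a *\<^sub>R T a)"
        unfolding g_def by (simp add: linear_sum[OF lin] linear_cmul[OF lin])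
      also have "\<dots> = (\<Sum>a\<in>{a \<in> t. e a = \<mu>}. \<mu> *\<^sub>R (r a *\<^sub>R a))"
        using e by (intro sum.cong refl) (auto simp: is_eigenvector_def)
      finally show ?thesis by (simp add: g_def scaleR_sum_right)
    qed
    show "f = (\<Sum>\<mu>\<in>e ` t. g \<mu>)"
      unfolding f_eq g_def using t(1) by (intro sum.group[symmetric]) auto
    show "\<mu> \<le> \<omega> \<and> (\<exists>x. is_eigenvector T \<mu> x)" if "\<mu> \<in> e ` t" for \<mu>
      using that e by blast
  qed
qed

text \<open>
  Positive semidefiniteness enters because only an upper bound is imposed on the eigenvalues: it
  turns \<open>\<mu> \<le> \<omega>\<close> into \<open>\<mu>\<^sup>2 \<le> \<omega>\<^sup>2\<close>, and Pythagoras then compares the squared norms termwise.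
\<close>

lemma bernstein_inequality:
  fixes T :: "'a::real_inner \<Rightarrow> 'a"
  assumes lin: "linear T"
    and adj: "\<And>x y. T x \<bullet> y = x \<bullet> T y"
    and psd: "\<And>x. 0 \<le> x \<bullet> T x"
    and "0 \<le> \<omega>" and f: "f \<in> paley_wiener T \<omega>"
  shows "norm (T f) \<le> \<omega> * norm f"
proof -
  obtain M g where M: "finite M" and g: "\<And>\<mu>. T (g \<mu>) = \<mu> *\<^sub>R g \<mu>" and f_eq: "f = (\<Sum>\<mu>\<in>M. g \<mu>)"
    and M_le: "\<And>\<mu>. \<mu> \<in> M \<Longrightarrow> \<mu> \<le> \<omega> \<and> (\<exists>x. is_eigenvector T \<mu> x)"
    using paley_wiener_decomposition[OF lin f] by metis
  have M_ge: "0 \<le> \<mu>" if "\<mu> \<in> M" for \<mu>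
  proof -
    obtain x where "x \<noteq> 0" "T x = \<mu> *\<^sub>R x"
      using M_le[OF \<open>\<mu> \<in> M\<close>] unfolding is_eigenvector_def by blast
    then have "0 < x \<bullet> x" and "0 \<le> \<mu> * (x \<bullet> x)"
      using psd[of x] by simp_all
    then show ?thesis
      by (metis zero_le_mult_iff not_less)
  qed
  have orth: "g \<mu> \<bullet> g \<nu> = 0" if "\<mu> \<noteq> \<nu>" for \<mu> \<nu>
    using eigenspaces_orthogonal[OF adj g g that] .
  have norm_f: "(norm f)\<^sup>2 = (\<Sum>\<mu>\<in>M. (norm (g \<mu>))\<^sup>2)"
    unfolding f_eq by (rule norm_sum_Pythagorean[OF M]) (simp add: pairwise_def orthogonal_def orth)
  have "T f = (\<Sum>\<mu>\<in>M. \<mu> *\<^sub>R g \<mu>)"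
    unfolding f_eq by (simp add: linear_sum[OF lin] g)
  then have "(norm (T f))\<^sup>2 = (\<Sum>\<mu>\<in>M. (norm (\<mu> *\<^sub>R g \<mu>))\<^sup>2)"
    by (simp only:, intro norm_sum_Pythagorean[OF M]) (simp add: pairwise_def orthogonal_def orth)
  also have "\<dots> \<le> (\<Sum>\<mu>\<in>M. \<omega>\<^sup>2 * (norm (g \<mu>))\<^sup>2)"
    using M_le M_ge by (intro sum_mono) (auto simp: power_mult_distrib intro!: mult_right_mono power_mono)
  also have "\<dots> = (\<omega> * norm f)\<^sup>2"
    by (simp add: norm_f power_mult_distrib sum_distrib_left)
  finally show ?thesis
    by (rule power2_le_imp_le) (simp add: \<open>0 \<le> \<omega>\<close>)
qed

lemma paley_wiener_uniqueness:
  assumes "weighted_graph w" and "0 < \<Lambda>" and "Lambda_set w \<Lambda> (UNIV - U)"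
    and "0 < \<omega>" "\<omega> < 1 / \<Lambda>"
    and "f \<in> paley_wiener (laplacian w) \<omega>" and "\<And>u. u \<in> U \<Longrightarrow> f $ u = 0"
  shows "f = 0"
proof (rule ccontr)
  assume "f \<noteq> 0"
  have "norm f \<le> \<Lambda> * norm (laplacian w f)"
    using assms(3,7) by (auto simp: Lambda_set_def L2_on_def)
  also have "\<dots> \<le> \<Lambda> * (\<omega> * norm f)"
    using assms laplacian_self_adjoint laplacian_psd
    by (intro mult_left_mono bernstein_inequality linear_laplacian) auto
  also have "\<dots> = (\<Lambda> * \<omega>) * norm f"
    by simp
  also have "\<dots> < 1 * norm f"
    using assms(2,5) \<open>f \<noteq> 0\<close> by (intro mult_strict_right_mono) (auto simp: field_simps)
  finally show False by simp
qed

lemma paley_wiener_mono: "\<omega> \<le> \<omega>' \<Longrightarrow> paley_wiener T \<omega> \<subseteq> paley_wiener T \<omega>'"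
  unfolding paley_wiener_def by (intro span_mono Collect_mono) (metis order_trans)

lemma subspace_paley_wiener_Union:
  fixes c :: real
  assumes "0 < c"
  shows "subspace (\<Union>\<omega>\<in>{0<..<c}. paley_wiener T \<omega>)"
proof (rule subspaceI)
  have "c / 2 \<in> {0<..<c}" using assms by simp
  then show "0 \<in> (\<Union>\<omega>\<in>{0<..<c}. paley_wiener T \<omega>)"
    unfolding paley_wiener_def using span_zero by blast
next
  fix x y
  assume "x \<in> (\<Union>\<omega>\<in>{0<..<c}. paley_wiener T \<omega>)" "y \<in> (\<Union>\<omega>\<in>{0<..<c}. paley_wiener T \<omega>)"
  then obtain a b where ab: "a \<in> {0<..<c}" "b \<in> {0<..<c}"
    and xy: "x \<in> paley_wiener T a" "y \<in> paley_wiener T b"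
    by blast
  have "x \<in> paley_wiener T (max a b)" "y \<in> paley_wiener T (max a b)"
    using xy paley_wiener_mono[of a "max a b" T] paley_wiener_mono[of b "max a b" T] by auto
  then have "x + y \<in> paley_wiener T (max a b)"
    unfolding paley_wiener_def by (rule span_add)
  moreover have "max a b \<in> {0<..<c}" using ab by auto
  ultimately show "x + y \<in> (\<Union>\<omega>\<in>{0<..<c}. paley_wiener T \<omega>)" by blast
next
  fix r x
  assume "x \<in> (\<Union>\<omega>\<in>{0<..<c}. paley_wiener T \<omega>)"
  then show "r *\<^sub>R x \<in> (\<Union>\<omega>\<in>{0<..<c}. paley_wiener T \<omega>)"
    unfolding paley_wiener_def using span_scale by blast
qed

text \<open>
  The weight at \<open>u\<close> is the value of the functional on the function that the chosen left inverse
  \<open>E\<close> of the restriction map \<open>R\<close> assigns to the sample equal to 1 at \<open>u\<close> and 0 elsewhere.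
\<close>

lemma linear_functional_from_samples:
  fixes W :: "(real ^ 'v::finite) set" and \<phi> :: "real ^ 'v \<Rightarrow> real"
  assumes W: "subspace W" and \<phi>: "linear \<phi>"
    and unique: "\<And>f. f \<in> W \<Longrightarrow> (\<And>u. u \<in> U \<Longrightarrow> f $ u = 0) \<Longrightarrow> f = 0"
  shows "\<exists>\<sigma>. \<forall>f\<in>W. \<phi> f = (\<Sum>u\<in>U. f $ u * \<sigma> u)"
proof -
  define R :: "real ^ 'v \<Rightarrow> real ^ 'v" where "R f = (\<Sum>u\<in>U. f $ u *\<^sub>R axis u 1)" for f
  have R: "linear R"
    unfolding R_def by (rule linearI)
      (simp_all add: scaleR_add_left sum.distrib scaleR_sum_right)
  have R_nth: "R f $ v = f $ v" if "v \<in> U" for f v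
  proof -
    have "R f $ v = (\<Sum>u\<in>U. if u = v then f $ u else 0)"
      unfolding R_def sum_component by (intro sum.cong refl) (simp add: axis_def)
    then show ?thesis using that by simp
  qed
  have "inj_on R W"
  proof (subst linear_inj_on_iff_eq_0[OF R W], intro ballI impI)
    fix f assume "f \<in> W" and zero: "R f = 0"
    have "f $ u = 0" if "u \<in> U" for u
      using R_nth[OF that, of f] by (simp add: zero)
    with \<open>f \<in> W\<close> show "f = 0" by (rule unique)
  qed
  from linear_exists_left_inverse_on[OF R W this]
  obtain E where E: "linear E" "\<And>f. f \<in> W \<Longrightarrow> E (R f) = f"
    by metis
  have "\<phi> f = (\<Sum>u\<in>U. f $ u * \<phi> (E (axis u 1)))" if "f \<in> W" for f
  proof -
    have "\<phi> f = \<phi> (E (R f))" using E(2)[OF that] by simp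
    also have "\<dots> = (\<Sum>u\<in>U. f $ u * \<phi> (E (axis u 1)))"
      unfolding R_def
      by (simp add: linear_sum[OF E(1)] linear_cmul[OF E(1)] linear_sum[OF \<phi>] linear_cmul[OF \<phi>])
    finally show ?thesis .
  qed
  then show ?thesis
    by (intro exI[of _ "\<lambda>u. \<phi> (E (axis u 1))"] ballI)
qed

theorem theorem5p1:
  fixes w :: "'v::finite \<Rightarrow> 'v \<Rightarrow> real"
    and U :: "'v set"
    and \<Lambda> :: real
  assumes "weighted_graph w"
    and "0 < \<Lambda>"
    and "Lambda_set w \<Lambda> (UNIV - U)"
  shows "\<exists>\<sigma> :: 'v \<Rightarrow> real. \<forall>\<omega>. 0 < \<omega> \<and> \<omega> < 1 / \<Lambda> \<longrightarrow>
           (\<forall>f\<in>paley_wiener (laplacian w) \<omega>.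
              (\<Sum>v\<in>UNIV. f $ v) = (\<Sum>u\<in>U. f $ u * \<sigma> u))"
proof -
  let ?W = "\<Union>\<omega>\<in>{0<..<1 / \<Lambda>}. paley_wiener (laplacian w) \<omega>"
  have "\<exists>\<sigma>. \<forall>f\<in>?W. (\<Sum>v\<in>UNIV. f $ v) = (\<Sum>u\<in>U. f $ u * \<sigma> u)"
  proof (rule linear_functional_from_samples)
    show "subspace ?W"
      using assms(2) by (intro subspace_paley_wiener_Union) simp
    show "linear (\<lambda>f :: real ^ 'v. \<Sum>v\<in>UNIV. f $ v)"
      by (rule linearI) (simp_all add: sum.distrib sum_distrib_left)
    show "f = 0" if "f \<in> ?W" "\<And>u. u \<in> U \<Longrightarrow> f $ u = 0" for f
      using that paley_wiener_uniqueness[OF assms] by auto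
  qed
  then obtain \<sigma> where "\<forall>f\<in>?W. (\<Sum>v\<in>UNIV. f $ v) = (\<Sum>u\<in>U. f $ u * \<sigma> u)" ..
  then show ?thesis
    by (intro exI[of _ \<sigma>]) auto
qed

end
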